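(* Let $\Omega=(0,1)^2$, let $K(x)=\frac{1}{2\pi}\log\|x\|$ for $x\in\mathbb{R}^2\setminus\{0\}$, and let $\rho\in L^\infty(\Omega)$ be bounded inside $[0,\alpha]$ for some $\alpha>0$. Let $x\in\overline{\Omega}$ and select a neighbourhood size $0<\varepsilon\le\tfrac12$. Then the expression $$(K\star\rho)(x)\approx \mathcal{I}_1[\rho](x)+\widehat{\mathcal{I}}_2[\rho](x;\varepsilon)=\int_{\Omega\setminus B_\infty(x;\varepsilon)}K(x-y)\,\rho(y)\,dy+\rho(x)\,G_\varepsilon(x)$$ provides an $O(\varepsilon^2\log\varepsilon)$ pointwise approximation of $(K\star\rho)(x)=\int_\Omega K(x-y)\,\rho(y)\,dy$, which is exact for constant $\rho$.
   Context: $\|\cdot\|$ is the Euclidean norm on $\mathbb{R}^2$ and $B_\infty(x;\varepsilon)$ is the ball of radius $\varepsilon$ centred at $x$ in the maximum norm. The term $\mathcal{I}_1[\rho](x)=\int_{\Omega\setminus B_\infty(x;\varepsilon)}K(x-y)\,\rho(y)\,dy$ is the part of the convolution away from the singularity, and $\widehat{\mathcal{I}}_2[\rho](x;\varepsilon)=\rho(x)\,G_\varepsilon(x)$ is the piecewise-constant approximation of the remaining part $\int_{\Omega\cap B_\infty(x;\varepsilon)}K(x-y)\,\rho(y)\,dy$, where $$G_\varepsilon(x)=\int_{x-(\Omega\cap B_\infty(x;\varepsilon))}K(u)\,du,\qquad x-S=\{x-y:y\in S\}.$$ *)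

theory Defs
  imports "HOL-Analysis.Analysis" "HOL-Library.Landau_Symbols"
begin

(* Here 1 :: real^2 is the all-ones vector, so this is the open unit square. *)
definition Omega :: "(real^2) set" where
  "Omega = box 0 1"

(* The value at the origin (where ln 0 = 0) is a dummy value at the singularity. *)
definition K :: "real^2 \<Rightarrow> real" where
  "K x = 1 / (2 * pi) * ln (norm x)"

definition ball_inf :: "real^2 \<Rightarrow> real \<Rightarrow> (real^2) set" where
  "ball_inf x \<epsilon> = {y. infnorm (y - x) < \<epsilon>}"

(* rho is an arbitrary representative of an element of L^infinity(Omega), whence the bounds
   hold only almost everywhere.  It is a total function so that rho x makes sense
   on the closure of Omega. *)
definition bounded_density :: "real \<Rightarrow> (real^2 \<Rightarrow> real) \<Rightarrow> bool" where
  "bounded_density \<alpha> \<rho> \<longleftrightarrow>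
     \<rho> \<in> borel_measurable (lebesgue_on Omega) \<and>
     (AE y in lebesgue_on Omega. 0 \<le> \<rho> y \<and> \<rho> y \<le> \<alpha>)"

definition conv_K :: "(real^2 \<Rightarrow> real) \<Rightarrow> real^2 \<Rightarrow> real" where
  "conv_K \<rho> x = (LINT y:Omega|lebesgue. K (x - y) * \<rho> y)"

definition I1 :: "(real^2 \<Rightarrow> real) \<Rightarrow> real^2 \<Rightarrow> real \<Rightarrow> real" where
  "I1 \<rho> x \<epsilon> = (LINT y:(Omega - ball_inf x \<epsilon>)|lebesgue. K (x - y) * \<rho> y)"

definition G :: "real \<Rightarrow> real^2 \<Rightarrow> real" where
  "G \<epsilon> x = (LINT u:((\<lambda>y. x - y) ` (Omega \<inter> ball_inf x \<epsilon>))|lebesgue. K u)"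

definition I2_hat :: "(real^2 \<Rightarrow> real) \<Rightarrow> real^2 \<Rightarrow> real \<Rightarrow> real" where
  "I2_hat \<rho> x \<epsilon> = \<rho> x * G \<epsilon> x"

end

theory Submission
  imports Defs
begin

text \<open>
  The region away from \<open>x\<close> contributes identically to \<^term>\<open>conv_K \<rho> x\<close> and to its
  approximation, and the substitution \<open>u = x - y\<close> turns \<^term>\<open>G \<epsilon> x\<close> into an integral
  over the remaining region. Hence (\<open>approximation_error_eq\<close>) the error is the single integral of
  \<open>K (x - y) * (\<rho> y - \<rho> x)\<close> over \<open>Omega \<inter> ball_inf x \<epsilon>\<close>.
  It vanishes when \<open>\<rho>\<close> is constant, and since \<open>\<bar>\<rho> y - \<rho> x\<bar> \<le> \<alpha>\<close> almost
  everywhere, it is at most \<open>\<alpha>\<close> times the integral of \<open>\<bar>K (x - y)\<bar>\<close> over the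
  whole ball.

  The quantitative heart is therefore the bound \<open>2 * \<bar>\<epsilon>\<^sup>2 * ln \<epsilon>\<bar>\<close> for that last
  integral (\<open>nn_integral_abs_K\<close>). Polar coordinates are awkward on a square, so the
  logarithm is dominated by a sum over nested balls instead. Write \<open>t\<close> for the maximum norm of
  \<open>x - y\<close>. Then \<open>- ln t = - ln \<epsilon> + ln (\<epsilon> / t)\<close>, where the first term contributes
  \<open>- ln \<epsilon>\<close> times the area \<open>4 * \<epsilon>\<^sup>2\<close> of the ball, and the second is at most \<open>ln 2\<close>
  times the number of \<open>n\<close> with \<open>t < \<epsilon> / 2 ^ n\<close>. Integrating that count adds up
  the areas of the concentric balls of radii \<open>\<epsilon> / 2 ^ n\<close>, a geometric series of order
  \<open>\<epsilon>\<^sup>2\<close>, and \<open>\<epsilon>\<^sup>2\<close> is absorbed into \<open>\<epsilon>\<^sup>2 * \<bar>ln \<epsilon>\<bar>\<close> because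
  \<open>\<epsilon> \<le> 1 / 2\<close>.
\<close>

section \<open>The unit square and balls in the maximum norm\<close>

lemma Omega_borel [measurable]: "Omega \<in> sets borel"
  by (simp add: Omega_def)

lemma ball_inf_eq_box: "ball_inf x r = box (\<chi> i. x $ i - r) (\<chi> i. x $ i + r)"
  by (auto simp: ball_inf_def infnorm_2 mem_box_cart forall_2 abs_less_iff)

lemma ball_inf_borel [measurable]: "ball_inf x r \<in> sets borel"
  by (simp add: ball_inf_eq_box)

lemma emeasure_ball_inf:
  assumes "0 \<le> r"
  shows "emeasure lborel (ball_inf x r) = ennreal (4 * r\<^sup>2)"
proof -
  let ?a = "(\<chi> i. x $ i - r)::real^2" and ?b = "(\<chi> i. x $ i + r)::real^2"
  have "emeasure lborel (ball_inf x r) = ennreal (\<Prod>b\<in>Basis. (?b - ?a) \<bullet> b)"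
    unfolding ball_inf_eq_box using assms
    by (intro emeasure_lborel_box) (auto simp: Basis_vec_def inner_axis)
  also have "(\<Prod>b\<in>Basis. (?b - ?a) \<bullet> b) = (\<Prod>b\<in>(Basis :: (real^2) set). 2 * r)"
    by (intro prod.cong) (auto simp: Basis_vec_def inner_axis)
  finally show ?thesis by (simp add: power2_eq_square)
qed

section \<open>The logarithmic singularity\<close>

lemma borel_measurable_K [measurable]: "K \<in> borel_measurable borel"
  unfolding K_def by measurable

text \<open>
  The radii \<open>\<epsilon> / 2 ^ n\<close> exceeding \<open>t\<close> are those with \<open>n < log 2 (\<epsilon> / t)\<close>; there are
  \<open>\<lceil>log 2 (\<epsilon> / t)\<rceil>\<close> of them (none if \<open>\<epsilon> \<le> t\<close>), and each accounts for one \<open>ln 2\<close>.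
\<close>
lemma ln_le_dyadic_count:
  assumes "0 < t" "0 < \<epsilon>"
  shows "ennreal (ln (\<epsilon> / t)) \<le> (\<Sum>n. ennreal (ln 2) * indicator {..<\<epsilon> / 2 ^ n} t)"
proof -
  define N where "N = nat \<lceil>log 2 (\<epsilon> / t)\<rceil>"
  have below: "t < \<epsilon> / 2 ^ n" if "n < N" for n
  proof -
    have "real n < log 2 (\<epsilon> / t)" using that unfolding N_def by linarith
    then have "2 ^ n < \<epsilon> / t"
      using assms by (simp add: less_log_iff powr_realpow)
    then show ?thesis using assms by (simp add: field_simps)
  qed
  have "log 2 (\<epsilon> / t) \<le> real N" unfolding N_def by linarith
  then have "ln (\<epsilon> / t) \<le> real N * ln 2" by (simp add: log_def field_simps)
  then have "ennreal (ln (\<epsilon> / t)) \<le> (\<Sum>n<N. ennreal (ln 2))"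
    by (simp add: ennreal_of_nat_eq_real_of_nat flip: ennreal_mult')
  also have "\<dots> = (\<Sum>n<N. ennreal (ln 2) * indicator {..<\<epsilon> / 2 ^ n} t)"
    by (intro sum.cong) (auto simp: below)
  also have "\<dots> \<le> (\<Sum>n. ennreal (ln 2) * indicator {..<\<epsilon> / 2 ^ n} t)"
    by (intro sum_le_suminf) auto
  finally show ?thesis .
qed

text \<open>
  With radius at most one half, the maximum-norm ball lies inside the Euclidean unit disc
  (\<open>sqrt 2 / 2 < 1\<close>), where the logarithm is negative. There it grows in absolute value when the
  Euclidean norm is replaced by the smaller maximum norm.
\<close>
lemma abs_K_near_pole:
  assumes "0 < infnorm v" "infnorm v < \<epsilon>" "\<epsilon> \<le> 1 / 2"
  shows "\<bar>K v\<bar> \<le> 1 / (2 * pi) * (- ln \<epsilon> + ln (\<epsilon> / infnorm v))"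
proof -
  have "norm v \<le> sqrt 2 * infnorm v" using norm_le_infnorm[of v] by simp
  also have "\<dots> \<le> 2 * (1 / 2)"
    using assms by (intro mult_mono) (auto simp: real_sqrt_le_iff real_le_lsqrt infnorm_pos_le)
  finally have "norm v \<le> 1" by simp
  moreover have "0 < norm v" using assms(1) by (simp add: infnorm_pos_lt)
  moreover have "infnorm v \<le> norm v" by (rule infnorm_le_norm)
  ultimately have "\<bar>ln (norm v)\<bar> \<le> - ln (infnorm v)"
    using assms(1) by simp
  also have "\<dots> = - ln \<epsilon> + ln (\<epsilon> / infnorm v)" using assms by (simp add: ln_div)
  finally have "\<bar>ln (norm v)\<bar> \<le> - ln \<epsilon> + ln (\<epsilon> / infnorm v)" .
  then show ?thesis by (simp add: K_def abs_mult divide_right_mono)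
qed

lemma nn_integral_dyadic_balls:
  assumes "0 < \<epsilon>"
  shows "(\<integral>\<^sup>+ y. (\<Sum>n. ennreal (ln 2) * indicator (ball_inf x (\<epsilon> / 2 ^ n)) y) \<partial>lborel)
           = ennreal (16 / 3 * ln 2 * \<epsilon>\<^sup>2)"
proof -
  have "(\<integral>\<^sup>+ y. (\<Sum>n. ennreal (ln 2) * indicator (ball_inf x (\<epsilon> / 2 ^ n)) y) \<partial>lborel)
      = (\<Sum>n. \<integral>\<^sup>+ y. ennreal (ln 2) * indicator (ball_inf x (\<epsilon> / 2 ^ n)) y \<partial>lborel)"
    by (intro nn_integral_suminf) measurable
  also have "\<dots> = (\<Sum>n. ennreal (ln 2 * 4 * \<epsilon>\<^sup>2 * (1 / 4) ^ n))"
  proof (intro arg_cong[where f = suminf] ext)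
    fix n
    have "(2 ^ n)\<^sup>2 = (4 ^ n :: real)"
      by (simp add: power2_eq_square flip: power_mult_distrib)
    then have "ln 2 * (4 * (\<epsilon> / 2 ^ n)\<^sup>2) = ln 2 * 4 * \<epsilon>\<^sup>2 * (1 / 4) ^ n"
      by (simp add: power_divide)
    then show "(\<integral>\<^sup>+ y. ennreal (ln 2) * indicator (ball_inf x (\<epsilon> / 2 ^ n)) y \<partial>lborel)
        = ennreal (ln 2 * 4 * \<epsilon>\<^sup>2 * (1 / 4) ^ n)"
      using assms by (simp add: nn_integral_cmult_indicator emeasure_ball_inf flip: ennreal_mult')
  qed
  also have "\<dots> = ennreal (ln 2 * 4 * \<epsilon>\<^sup>2 * (1 / (1 - 1 / 4)))"
    by (intro suminf_ennreal_eq sums_mult geometric_sums) auto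
  finally show ?thesis by (simp add: mult_ac)
qed

text \<open>
  The two parts of the bound on the singularity add up to
  \<open>(4 + 16 / 3) / (2 * pi)\<close> times \<open>\<epsilon>\<^sup>2 * \<bar>ln \<epsilon>\<bar>\<close>, since
  \<open>ln 2 \<le> - ln \<epsilon>\<close>; the factor is rounded up to \<open>2\<close>.
\<close>
lemma nn_integral_abs_K:
  assumes "0 < \<epsilon>" "\<epsilon> \<le> 1 / 2"
  shows "(\<integral>\<^sup>+ y. ennreal \<bar>K (x - y)\<bar> * indicator (ball_inf x \<epsilon>) y \<partial>lborel)
           \<le> ennreal (2 * \<bar>\<epsilon>\<^sup>2 * ln \<epsilon>\<bar>)"
proof -
  define S where "S y = (\<Sum>n. ennreal (ln 2) * indicator (ball_inf x (\<epsilon> / 2 ^ n)) y)" for y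
  have [measurable]: "S \<in> borel_measurable borel" unfolding S_def by measurable
  have ln_eps: "ln 2 \<le> - ln \<epsilon>"
  proof -
    have "ln \<epsilon> \<le> ln (1 / 2)" using assms by (subst ln_le_cancel_iff) auto
    then show ?thesis by (simp add: ln_div)
  qed
  then have ln_eps_neg: "ln \<epsilon> < 0" using ln_gt_zero[of "2::real"] by linarith
  have pt: "ennreal \<bar>K (x - y)\<bar> * indicator (ball_inf x \<epsilon>) y
      \<le> ennreal (1 / (2 * pi)) * (ennreal (- ln \<epsilon>) * indicator (ball_inf x \<epsilon>) y + S y)" for y
  proof (cases "y \<in> ball_inf x \<epsilon> \<and> y \<noteq> x")
    case True
    define t where "t = infnorm (x - y)"
    have t: "0 < t" "t < \<epsilon>"
      using True by (auto simp: t_def infnorm_pos_lt ball_inf_def infnorm_sub)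
    have "ennreal \<bar>K (x - y)\<bar> \<le> ennreal (1 / (2 * pi) * (- ln \<epsilon> + ln (\<epsilon> / t)))"
      using abs_K_near_pole[of "x - y" \<epsilon>] t assms by (intro ennreal_leI) (simp add: t_def)
    also have "\<dots> = ennreal (1 / (2 * pi)) * (ennreal (- ln \<epsilon>) + ennreal (ln (\<epsilon> / t)))"
      using t ln_eps_neg by (subst ennreal_mult', simp, subst ennreal_plus) auto
    also have "ennreal (ln (\<epsilon> / t)) \<le> S y"
      using ln_le_dyadic_count[OF t(1) assms(1)]
      by (simp add: S_def t_def ball_inf_def infnorm_sub indicator_def)
    finally show ?thesis using True by (simp add: mult_left_mono add_left_mono)
  next
    case False
    \<comment> \<open>At the pole itself the bound holds because \<open>ln 0 = 0\<close> makes \<open>K 0\<close> vanish.\<close>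
    then show ?thesis by (auto simp: K_def)
  qed
  have "(\<integral>\<^sup>+ y. ennreal \<bar>K (x - y)\<bar> * indicator (ball_inf x \<epsilon>) y \<partial>lborel)
      \<le> (\<integral>\<^sup>+ y. ennreal (1 / (2 * pi)) *
            (ennreal (- ln \<epsilon>) * indicator (ball_inf x \<epsilon>) y + S y) \<partial>lborel)"
    by (intro nn_integral_mono pt)
  also have "\<dots> = ennreal (1 / (2 * pi)) *
      (ennreal (- ln \<epsilon>) * emeasure lborel (ball_inf x \<epsilon>) + (\<integral>\<^sup>+ y. S y \<partial>lborel))"
    by (simp add: nn_integral_cmult nn_integral_add nn_integral_cmult_indicator)
  also have "\<dots> = ennreal (1 / (2 * pi) * (- ln \<epsilon> * (4 * \<epsilon>\<^sup>2) + 16 / 3 * ln 2 * \<epsilon>\<^sup>2))"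
  proof -
    have "ennreal (c * (a + b)) = ennreal c * (ennreal a + ennreal b)"
      if "0 \<le> c" "0 \<le> a" "0 \<le> b" for a b c :: real
      using that by (simp add: ennreal_mult')
    from this[of "1 / (2 * pi)" "- ln \<epsilon> * (4 * \<epsilon>\<^sup>2)" "16 / 3 * ln 2 * \<epsilon>\<^sup>2"]
    have "ennreal (1 / (2 * pi) * (- ln \<epsilon> * (4 * \<epsilon>\<^sup>2) + 16 / 3 * ln 2 * \<epsilon>\<^sup>2))
        = ennreal (1 / (2 * pi)) *
            (ennreal (- ln \<epsilon> * (4 * \<epsilon>\<^sup>2)) + ennreal (16 / 3 * ln 2 * \<epsilon>\<^sup>2))"
      using ln_eps_neg by (auto simp: mult_nonpos_nonneg)
    moreover have "(\<integral>\<^sup>+ y. S y \<partial>lborel) = ennreal (16 / 3 * ln 2 * \<epsilon>\<^sup>2)"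
      unfolding S_def by (rule nn_integral_dyadic_balls[OF assms(1)])
    moreover have "ennreal (- ln \<epsilon>) * emeasure lborel (ball_inf x \<epsilon>)
        = ennreal (- ln \<epsilon> * (4 * \<epsilon>\<^sup>2))"
      using assms ln_eps_neg by (subst ennreal_mult') (auto simp: emeasure_ball_inf)
    ultimately show ?thesis by (simp only:)
  qed
  also have "\<dots> \<le> ennreal (2 * \<bar>\<epsilon>\<^sup>2 * ln \<epsilon>\<bar>)"
  proof (intro ennreal_leI)
    have "16 / 3 * ln 2 * \<epsilon>\<^sup>2 \<le> 16 / 3 * (- ln \<epsilon>) * \<epsilon>\<^sup>2"
      using ln_eps by (intro mult_right_mono) auto
    then have "- ln \<epsilon> * (4 * \<epsilon>\<^sup>2) + 16 / 3 * ln 2 * \<epsilon>\<^sup>2 \<le> 28 / 3 * \<bar>\<epsilon>\<^sup>2 * ln \<epsilon>\<bar>"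
      using ln_eps_neg by (simp add: abs_mult algebra_simps)
    also have "\<dots> \<le> (2 * pi) * (2 * \<bar>\<epsilon>\<^sup>2 * ln \<epsilon>\<bar>)"
      using pi_gt3 by (simp flip: mult.assoc add: mult_right_mono)
    finally show "1 / (2 * pi) * (- ln \<epsilon> * (4 * \<epsilon>\<^sup>2) + 16 / 3 * ln 2 * \<epsilon>\<^sup>2) \<le> 2 * \<bar>\<epsilon>\<^sup>2 * ln \<epsilon>\<bar>"
      by (simp add: field_simps)
  qed
  finally show ?thesis .
qed

lemma set_integrable_K_ball_inf:
  assumes "0 < \<epsilon>" "\<epsilon> \<le> 1 / 2"
  shows "set_integrable lebesgue (ball_inf x \<epsilon>) (\<lambda>y. K (x - y))"
proof -
  have "(\<integral>\<^sup>+ y. ennreal (norm (indicator (ball_inf x \<epsilon>) y *\<^sub>R K (x - y))) \<partial>lborel)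
      = (\<integral>\<^sup>+ y. ennreal \<bar>K (x - y)\<bar> * indicator (ball_inf x \<epsilon>) y \<partial>lborel)"
    by (intro nn_integral_cong) (auto simp: indicator_def)
  also have "\<dots> < \<infinity>"
    using nn_integral_abs_K[OF assms, of x] by (auto simp: top_unique less_top[symmetric])
  finally have "integrable lborel (\<lambda>y. indicator (ball_inf x \<epsilon>) y *\<^sub>R K (x - y))"
    by (intro integrableI_bounded) measurable
  then show ?thesis
    unfolding set_integrable_def by (subst integrable_completion) measurable
qed

lemma set_integral_abs_K_le:
  assumes "0 < \<epsilon>" "\<epsilon> \<le> 1 / 2"
  shows "(LINT y:ball_inf x \<epsilon>|lebesgue. \<bar>K (x - y)\<bar>) \<le> 2 * \<bar>\<epsilon>\<^sup>2 * ln \<epsilon>\<bar>"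
proof -
  have "(LINT y:ball_inf x \<epsilon>|lebesgue. \<bar>K (x - y)\<bar>)
      = (LINT y|lborel. indicator (ball_inf x \<epsilon>) y *\<^sub>R \<bar>K (x - y)\<bar>)"
    unfolding set_lebesgue_integral_def by (subst integral_completion) measurable
  also have "\<dots> \<le> 2 * \<bar>\<epsilon>\<^sup>2 * ln \<epsilon>\<bar>"
  proof (rule integral_real_bounded)
    have "(\<integral>\<^sup>+ y. ennreal (indicator (ball_inf x \<epsilon>) y *\<^sub>R \<bar>K (x - y)\<bar>) \<partial>lborel)
      = (\<integral>\<^sup>+ y. ennreal \<bar>K (x - y)\<bar> * indicator (ball_inf x \<epsilon>) y \<partial>lborel)"
      by (intro nn_integral_cong) (auto simp: indicator_def)
    then show "(\<integral>\<^sup>+ y. ennreal (indicator (ball_inf x \<epsilon>) y *\<^sub>R \<bar>K (x - y)\<bar>) \<partial>lborel)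
      \<le> ennreal (2 * \<bar>\<epsilon>\<^sup>2 * ln \<epsilon>\<bar>)" using nn_integral_abs_K[OF assms, of x] by simp
  qed simp
  finally show ?thesis .
qed

section \<open>Rewriting the approximation error\<close>

lemma distr_lborel_reflect:
  fixes x :: "'a::euclidean_space"
  shows "distr lborel borel (\<lambda>y. x - y) = lborel"
  by (subst lborel_affine[of "-1" x]) (auto simp: density_1)

lemma G_eq: "G \<epsilon> x = (LINT y:(Omega \<inter> ball_inf x \<epsilon>)|lebesgue. K (x - y))"
proof -
  let ?D = "Omega \<inter> ball_inf x \<epsilon>"
  have img: "(\<lambda>y. x - y) ` ?D = (\<lambda>u. x - u) -` ?D"
    by (force simp: image_iff)
  have [measurable]: "(\<lambda>y. x - y) ` ?D \<in> sets borel"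
    unfolding img by (rule measurable_sets_borel[where M = borel]) measurable
  have "G \<epsilon> x = (LINT u|lborel. indicator ((\<lambda>y. x - y) ` ?D) u *\<^sub>R K u)"
    unfolding G_def set_lebesgue_integral_def by (subst integral_completion) measurable
  also have "\<dots> = (LINT u|distr lborel borel (\<lambda>y. x - y). indicator ((\<lambda>y. x - y) ` ?D) u *\<^sub>R K u)"
    by (simp only: distr_lborel_reflect)
  also have "\<dots> = (LINT y|lborel. indicator ((\<lambda>y. x - y) ` ?D) (x - y) *\<^sub>R K (x - y))"
    by (rule integral_distr) measurable
  also have "\<dots> = (LINT y|lborel. indicator ?D y *\<^sub>R K (x - y))"
    unfolding img by (simp add: indicator_def)
  also have "\<dots> = (LINT y:?D|lebesgue. K (x - y))"
    unfolding set_lebesgue_integral_def by (subst integral_completion) measurable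
  finally show ?thesis .
qed

text \<open>
  Away from the pole the kernel is bounded, since the Euclidean distance lies between
  \<open>\<epsilon>\<close> and \<open>2\<close>. The bound is crude: it only serves to make the far integral exist, so that
  the convolution splits.
\<close>
lemma abs_K_away_from_pole:
  assumes "x \<in> closure Omega" "y \<in> Omega - ball_inf x \<epsilon>" "0 < \<epsilon>" "\<epsilon> \<le> 1"
  shows "\<bar>K (x - y)\<bar> \<le> ln (2 / \<epsilon>)"
proof -
  have x: "x \<in> cbox 0 1"
    using assms(1) closure_minimal[OF box_subset_cbox closed_cbox] unfolding Omega_def by blast
  have "norm (x - y) \<le> (\<Sum>i\<in>UNIV. \<bar>(x - y) $ i\<bar>)" by (rule norm_le_l1_cart)
  also have "\<dots> \<le> 2"
    using x assms(2) by (auto simp: Omega_def mem_box_cart forall_2 sum_2)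
  finally have up: "norm (x - y) \<le> 2" .
  have lo: "\<epsilon> \<le> norm (x - y)"
    using assms(2) infnorm_le_norm[of "x - y"] by (auto simp: ball_inf_def infnorm_sub)
  have "ln \<epsilon> \<le> ln (norm (x - y))" "ln (norm (x - y)) \<le> ln 2" "ln \<epsilon> \<le> 0" "0 \<le> ln (2::real)"
    using up lo assms(3,4) by (auto intro!: ln_mono)
  then have "\<bar>ln (norm (x - y))\<bar> \<le> ln 2 - ln \<epsilon>" by linarith
  also have "\<dots> = ln (2 / \<epsilon>)" using assms(3) by (simp add: ln_div)
  finally have le: "\<bar>ln (norm (x - y))\<bar> \<le> ln (2 / \<epsilon>)" .
  have "\<bar>K (x - y)\<bar> = \<bar>ln (norm (x - y))\<bar> / (2 * pi)" by (simp add: K_def abs_mult)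
  also have "\<dots> \<le> \<bar>ln (norm (x - y))\<bar> / 1"
    using pi_gt3 by (intro divide_left_mono) auto
  finally show ?thesis using le by simp
qed

text \<open>
  Nothing is known about \<open>\<rho>\<close> outside the unit square, so it is first cut off there.
\<close>
lemma set_borel_measurable_K_density:
  assumes "\<rho> \<in> borel_measurable (lebesgue_on Omega)" "A \<subseteq> Omega" "A \<in> sets lebesgue"
  shows "set_borel_measurable lebesgue A (\<lambda>y. K (x - y) * \<rho> y)"
proof -
  have "set_borel_measurable lebesgue Omega \<rho>"
    using assms(1) borel_measurable_restrict_space_iff[of Omega lebesgue \<rho>]
    by (simp add: set_borel_measurable_def)
  then have [measurable]: "(\<lambda>y. indicator Omega y *\<^sub>R \<rho> y) \<in> borel_measurable lebesgue"
    unfolding set_borel_measurable_def .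
  have [measurable]: "(\<lambda>y. K (x - y)) \<in> borel_measurable lebesgue"
    by (rule measurable_completion) measurable
  note assms(3)[measurable]
  have "(\<lambda>y. indicator A y *\<^sub>R (K (x - y) * (indicator Omega y *\<^sub>R \<rho> y))) \<in> borel_measurable lebesgue"
    by measurable
  also have "(\<lambda>y. indicator A y *\<^sub>R (K (x - y) * (indicator Omega y *\<^sub>R \<rho> y)))
      = (\<lambda>y. indicator A y *\<^sub>R (K (x - y) * \<rho> y))"
    using assms(2) by (auto simp: indicator_def fun_eq_iff)
  finally show ?thesis unfolding set_borel_measurable_def .
qed

lemma AE_bounded_density:
  assumes "bounded_density \<alpha> \<rho>"
  shows "AE y in lebesgue. y \<in> Omega \<longrightarrow> 0 \<le> \<rho> y \<and> \<rho> y \<le> \<alpha>"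
  using assms unfolding bounded_density_def by (subst (asm) AE_restrict_space_iff) auto

lemma set_integrable_K_density_near:
  assumes "bounded_density \<alpha> \<rho>" "0 < \<epsilon>" "\<epsilon> \<le> 1 / 2"
  shows "set_integrable lebesgue (Omega \<inter> ball_inf x \<epsilon>) (\<lambda>y. K (x - y) * \<rho> y)"
proof (rule set_integrable_bound)
  show "set_integrable lebesgue (Omega \<inter> ball_inf x \<epsilon>) (\<lambda>y. \<alpha> * K (x - y))"
    by (rule set_integrable_subset[OF set_integrable_mult_right[OF set_integrable_K_ball_inf[OF assms(2,3)]]]) auto
  show "set_borel_measurable lebesgue (Omega \<inter> ball_inf x \<epsilon>) (\<lambda>y. K (x - y) * \<rho> y)"
    using assms(1) by (intro set_borel_measurable_K_density) (auto simp: bounded_density_def)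
  show "AE y in lebesgue. y \<in> Omega \<inter> ball_inf x \<epsilon> \<longrightarrow>
      norm (K (x - y) * \<rho> y) \<le> norm (\<alpha> * K (x - y))"
    using AE_bounded_density[OF assms(1)]
    by eventually_elim (auto simp: abs_mult mult.commute intro!: mult_right_mono)
qed

lemma set_integrable_K_density_far:
  assumes "bounded_density \<alpha> \<rho>" "x \<in> closure Omega" "0 < \<epsilon>" "\<epsilon> \<le> 1"
  shows "set_integrable lebesgue (Omega - ball_inf x \<epsilon>) (\<lambda>y. K (x - y) * \<rho> y)"
  unfolding set_integrable_def
proof (rule integrableI_bounded_set)
  let ?A = "Omega - ball_inf x \<epsilon>"
  show "?A \<in> sets lebesgue" by auto
  show "(\<lambda>y. indicator ?A y *\<^sub>R (K (x - y) * \<rho> y)) \<in> borel_measurable lebesgue"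
    using set_borel_measurable_K_density[of \<rho> ?A x] assms(1)
    by (simp add: bounded_density_def set_borel_measurable_def)
  have "emeasure lebesgue ?A \<le> emeasure lebesgue Omega" by (intro emeasure_mono) auto
  also have "\<dots> < \<infinity>" using emeasure_lborel_box_finite[of 0 "1::real^2"] by (simp add: Omega_def)
  finally show "emeasure lebesgue ?A < \<infinity>" .
  show "AE y in lebesgue. y \<in> ?A \<longrightarrow>
      norm (indicator ?A y *\<^sub>R (K (x - y) * \<rho> y)) \<le> ln (2 / \<epsilon>) * \<alpha>"
    using AE_bounded_density[OF assms(1)]
  proof eventually_elim
    case (elim y)
    then show ?case
      using abs_K_away_from_pole[OF assms(2) _ assms(3,4), of y]
      by (auto simp: abs_mult intro!: mult_mono)
  qed
qed auto

text \<open>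
  The Bochner integral of a non-integrable function is zero by convention, so the splitting of the
  convolution and the subtraction of the constant term both rest on the integrability of the
  separate pieces; the integrability of the difference is kept for the estimate.
\<close>
lemma approximation_error_eq:
  assumes "bounded_density \<alpha> \<rho>" "x \<in> closure Omega" "0 < \<epsilon>" "\<epsilon> \<le> 1 / 2"
  shows "set_integrable lebesgue (Omega \<inter> ball_inf x \<epsilon>) (\<lambda>y. K (x - y) * (\<rho> y - \<rho> x))"
    and "conv_K \<rho> x - (I1 \<rho> x \<epsilon> + I2_hat \<rho> x \<epsilon>)
      = (LINT y:(Omega \<inter> ball_inf x \<epsilon>)|lebesgue. K (x - y) * (\<rho> y - \<rho> x))"
proof -
  let ?A = "Omega - ball_inf x \<epsilon>" and ?D = "Omega \<inter> ball_inf x \<epsilon>"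
  have far: "set_integrable lebesgue ?A (\<lambda>y. K (x - y) * \<rho> y)"
    using assms by (intro set_integrable_K_density_far) auto
  have near: "set_integrable lebesgue ?D (\<lambda>y. K (x - y) * \<rho> y)"
    using assms by (intro set_integrable_K_density_near)
  have const: "set_integrable lebesgue ?D (\<lambda>y. K (x - y) * \<rho> x)"
    by (rule set_integrable_subset[OF set_integrable_mult_left[OF set_integrable_K_ball_inf[OF assms(3,4)]]]) auto
  show "set_integrable lebesgue ?D (\<lambda>y. K (x - y) * (\<rho> y - \<rho> x))"
    using set_integral_diff(1)[OF near const] by (simp add: algebra_simps)
  have "conv_K \<rho> x = (LINT y:(?A \<union> ?D)|lebesgue. K (x - y) * \<rho> y)"
    by (simp add: conv_K_def Un_Diff_Int)
  also have "\<dots> = I1 \<rho> x \<epsilon> + (LINT y:?D|lebesgue. K (x - y) * \<rho> y)"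
    unfolding I1_def by (rule set_integral_Un[OF _ far near]) auto
  finally show "conv_K \<rho> x - (I1 \<rho> x \<epsilon> + I2_hat \<rho> x \<epsilon>)
      = (LINT y:?D|lebesgue. K (x - y) * (\<rho> y - \<rho> x))"
    using set_integral_diff(2)[OF near const]
    by (simp add: I2_hat_def G_eq algebra_simps)
qed

section \<open>Error bound and exactness\<close>

lemma approximation_error_bound:
  assumes "bounded_density \<alpha> \<rho>" "x \<in> closure Omega" "\<rho> x \<in> {0..\<alpha>}" "0 < \<epsilon>" "\<epsilon> \<le> 1 / 2"
  shows "\<bar>conv_K \<rho> x - (I1 \<rho> x \<epsilon> + I2_hat \<rho> x \<epsilon>)\<bar> \<le> 2 * \<alpha> * \<bar>\<epsilon>\<^sup>2 * ln \<epsilon>\<bar>"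
proof -
  let ?B = "ball_inf x \<epsilon>"
  let ?D = "Omega \<inter> ?B"
  note int = approximation_error_eq(1)[OF assms(1,2,4,5)]
  have absK: "set_integrable lebesgue ?B (\<lambda>y. \<alpha> * \<bar>K (x - y)\<bar>)"
    using set_integrable_abs[OF set_integrable_K_ball_inf[OF assms(4,5), of x]]
    by (intro set_integrable_mult_right)
  have "\<alpha> \<ge> 0" using assms(3) by auto
  have "\<bar>LINT y:?D|lebesgue. K (x - y) * (\<rho> y - \<rho> x)\<bar>
      \<le> (LINT y:?D|lebesgue. \<bar>K (x - y) * (\<rho> y - \<rho> x)\<bar>)"
    using set_integral_norm_bound[OF int] by simp
  also have "\<dots> \<le> (LINT y:?B|lebesgue. \<alpha> * \<bar>K (x - y)\<bar>)"
    unfolding set_lebesgue_integral_def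
  proof (rule integral_mono_AE)
    show "integrable lebesgue (\<lambda>y. indicator ?D y *\<^sub>R \<bar>K (x - y) * (\<rho> y - \<rho> x)\<bar>)"
      using set_integrable_abs[OF int] by (simp add: set_integrable_def)
    show "integrable lebesgue (\<lambda>y. indicator ?B y *\<^sub>R (\<alpha> * \<bar>K (x - y)\<bar>))"
      using absK by (simp add: set_integrable_def)
    show "AE y in lebesgue. indicator ?D y *\<^sub>R \<bar>K (x - y) * (\<rho> y - \<rho> x)\<bar>
        \<le> indicator ?B y *\<^sub>R (\<alpha> * \<bar>K (x - y)\<bar>)"
      using AE_bounded_density[OF assms(1)]
    proof eventually_elim
      case (elim y)
      \<comment> \<open>Both values lie in \<open>{0..\<alpha>}\<close>, so the oscillation is \<open>\<alpha>\<close> rather than \<open>2 * \<alpha>\<close>.\<close>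
      have "\<bar>\<rho> y - \<rho> x\<bar> \<le> \<alpha>" if "y \<in> Omega" using elim that assms(3) by auto
      then show ?case
        using \<open>\<alpha> \<ge> 0\<close>
        by (auto simp: indicator_def abs_mult mult.commute[of \<alpha>] intro!: mult_left_mono)
    qed
  qed
  also have "\<dots> \<le> \<alpha> * (2 * \<bar>\<epsilon>\<^sup>2 * ln \<epsilon>\<bar>)"
    using mult_left_mono[OF set_integral_abs_K_le[OF assms(4,5), of x] \<open>\<alpha> \<ge> 0\<close>] by simp
  finally show ?thesis
    unfolding approximation_error_eq(2)[OF assms(1,2,4,5)] by (simp add: mult_ac)
qed

lemma approximation_exact_for_const:
  assumes "bounded_density \<alpha> \<rho>" "x \<in> closure Omega" "0 < \<epsilon>" "\<epsilon> \<le> 1 / 2"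
    and "AE y in lebesgue_on Omega. \<rho> y = \<rho> x"
  shows "conv_K \<rho> x = I1 \<rho> x \<epsilon> + I2_hat \<rho> x \<epsilon>"
proof -
  have "AE y in lebesgue. y \<in> Omega \<longrightarrow> \<rho> y = \<rho> x"
    using assms(5) by (subst (asm) AE_restrict_space_iff) auto
  then have "(LINT y:(Omega \<inter> ball_inf x \<epsilon>)|lebesgue. K (x - y) * (\<rho> y - \<rho> x)) = 0"
    unfolding set_lebesgue_integral_def
    by (intro integral_eq_zero_AE) (auto simp: indicator_def elim!: eventually_mono)
  then show ?thesis using approximation_error_eq(2)[OF assms(1-4)] by simp
qed

theorem theorem3p4:
  fixes \<alpha> :: real
  assumes "\<alpha> > 0"
  shows "(\<exists>C>0. \<forall>\<rho> x \<epsilon>.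
            bounded_density \<alpha> \<rho> \<longrightarrow> x \<in> closure Omega \<longrightarrow> \<rho> x \<in> {0..\<alpha>} \<longrightarrow>
            0 < \<epsilon> \<longrightarrow> \<epsilon> \<le> 1 / 2 \<longrightarrow>
            \<bar>conv_K \<rho> x - (I1 \<rho> x \<epsilon> + I2_hat \<rho> x \<epsilon>)\<bar> \<le> C * \<bar>\<epsilon>\<^sup>2 * ln \<epsilon>\<bar>) \<and>
         (\<forall>\<rho> x.
            bounded_density \<alpha> \<rho> \<longrightarrow> x \<in> closure Omega \<longrightarrow> \<rho> x \<in> {0..\<alpha>} \<longrightarrow>
            (\<lambda>\<epsilon>. conv_K \<rho> x - (I1 \<rho> x \<epsilon> + I2_hat \<rho> x \<epsilon>))
              \<in> O[at_right 0](\<lambda>\<epsilon>. \<epsilon>\<^sup>2 * ln \<epsilon>)) \<and>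
         (\<forall>\<rho> x \<epsilon> c.
            bounded_density \<alpha> \<rho> \<longrightarrow> x \<in> closure Omega \<longrightarrow> \<rho> x \<in> {0..\<alpha>} \<longrightarrow>
            0 < \<epsilon> \<longrightarrow> \<epsilon> \<le> 1 / 2 \<longrightarrow>
            (AE y in lebesgue_on Omega. \<rho> y = c) \<longrightarrow> \<rho> x = c \<longrightarrow>
            conv_K \<rho> x = I1 \<rho> x \<epsilon> + I2_hat \<rho> x \<epsilon>)"
proof (intro conjI allI impI)
  show "\<exists>C>0. \<forall>\<rho> x \<epsilon>.
            bounded_density \<alpha> \<rho> \<longrightarrow> x \<in> closure Omega \<longrightarrow> \<rho> x \<in> {0..\<alpha>} \<longrightarrow>
            0 < \<epsilon> \<longrightarrow> \<epsilon> \<le> 1 / 2 \<longrightarrow>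
            \<bar>conv_K \<rho> x - (I1 \<rho> x \<epsilon> + I2_hat \<rho> x \<epsilon>)\<bar> \<le> C * \<bar>\<epsilon>\<^sup>2 * ln \<epsilon>\<bar>"
    using assms approximation_error_bound by (intro exI[of _ "2 * \<alpha>"]) auto
next
  fix \<rho> and x :: "real^2"
  assume "bounded_density \<alpha> \<rho>" "x \<in> closure Omega" "\<rho> x \<in> {0..\<alpha>}"
  note bound = approximation_error_bound[OF this]
  have "eventually (\<lambda>\<epsilon>::real. \<epsilon> \<in> {0<..<1/2}) (at_right 0)"
    by (intro eventually_at_right_real) auto
  then show "(\<lambda>\<epsilon>. conv_K \<rho> x - (I1 \<rho> x \<epsilon> + I2_hat \<rho> x \<epsilon>)) \<in> O[at_right 0](\<lambda>\<epsilon>. \<epsilon>\<^sup>2 * ln \<epsilon>)"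
    using bound by (intro bigoI[of _ "2 * \<alpha>"]) (auto elim!: eventually_mono)
next
  fix \<rho> and x :: "real^2" and \<epsilon> c :: real
  assume "bounded_density \<alpha> \<rho>" "x \<in> closure Omega" "0 < \<epsilon>" "\<epsilon> \<le> 1 / 2"
    "AE y in lebesgue_on Omega. \<rho> y = c" "\<rho> x = c"
  then show "conv_K \<rho> x = I1 \<rho> x \<epsilon> + I2_hat \<rho> x \<epsilon>"
    by (intro approximation_exact_for_const) auto
qed

end
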